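(* For every positive integer $N$ there exist an integer $n\ge N$ and a 2-comparable set of triples with all coordinates in $[n]=\{1,\dots,n\}$ of size at least $n^{1.546}$.
   Context: For integer triples $a=(a_1,a_2,a_3)$ and $b=(b_1,b_2,b_3)$, write $a<_2b$ if $a_i<b_i$ for at least two indices $i\in\{1,2,3\}$. Two triples are 2-comparable if one of them is 2-less than the other; a set of triples is 2-comparable if any two distinct elements of it are 2-comparable. *)

theory Defs
  imports "HOL-Analysis.Analysis"
begin

definition two_less :: "int ^ 3 \<Rightarrow> int ^ 3 \<Rightarrow> bool"  (infix "<\<^sub>2" 50) where
  "a <\<^sub>2 b \<longleftrightarrow> card {i. a $ i < b $ i} \<ge> 2"

definition two_comparable :: "int ^ 3 \<Rightarrow> int ^ 3 \<Rightarrow> bool" where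
  "two_comparable a b \<longleftrightarrow> a <\<^sub>2 b \<or> b <\<^sub>2 a"

definition two_comparable_set :: "(int ^ 3) set \<Rightarrow> bool" where
  "two_comparable_set A \<longleftrightarrow> (\<forall>a\<in>A. \<forall>b\<in>A. a \<noteq> b \<longrightarrow> two_comparable a b)"

end

theory Submission
  imports Defs "HOL-Library.Multiset" "HOL-Real_Asymp.Real_Asymp"
begin

text \<open>
  Substituting a 2-comparable set into every point of another one, with each coordinate ordered
  lexicographically, gives a 2-comparable set. So the words over a finite 2-comparable set S form a
  2-comparable set. Give the letters of each coordinate probabilities, with p(s) the product of the
  probabilities of the three coordinates of s. If \<open>\<Sum>s\<in>S. p(s)\<^sup>\<theta> = \<Lambda> > 1\<close>, then the words of length L have
  total weight \<open>\<Lambda>\<^sup>L\<close>, and as there are only polynomially many letter frequencies, the words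
  with some fixed letter frequencies have weight at least 1. In such a class all words have the
  same probability in each coordinate, so this probability bounds the inverse of the number of
  values of that coordinate, and the class has at least \<open>(n\<^sub>1 n\<^sub>2 n\<^sub>3)\<^sup>\<theta>\<close> elements, where \<open>n\<^sub>i\<close> is the number
  of values of coordinate i. Multiplying the class with its two cyclic rotations makes all three
  numbers of values equal to \<open>n\<^sub>1 n\<^sub>2 n\<^sub>3\<close> and gives the exponent \<open>3\<theta>\<close>.

  The set S = {000, 222, 210, 102, 021} admits an exponent of about 1.54626.
\<close>

section \<open>Lexicographic products\<close>

lemma two_comparable_irrefl: "\<not> two_comparable a a"
  by (simp add: two_comparable_def two_less_def)

text \<open>Comparability is irreflexive, so sizes are preserved without separate injectivity
  arguments.\<close>

lemma inj_on_if_two_comparable: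
  assumes "\<And>x y. \<lbrakk>x \<in> A; y \<in> A; x \<noteq> y\<rbrakk> \<Longrightarrow> two_comparable (f x) (f y)"
  shows "inj_on f A"
proof (rule inj_onI, rule ccontr)
  fix x y
  assume "x \<in> A" "y \<in> A" "f x = f y" "x \<noteq> y"
  then show False
    using assms[of x y] two_comparable_irrefl[of "f y"] by simp
qed

lemma two_comparable_set_image:
  assumes "\<And>x y. \<lbrakk>x \<in> A; y \<in> A; x \<noteq> y\<rbrakk> \<Longrightarrow> two_comparable (f x) (f y)"
  shows "two_comparable_set (f ` A)"
  unfolding two_comparable_set_def using assms by fast

lemma two_less_mono:
  assumes "a <\<^sub>2 b" "\<And>i. a $ i < b $ i \<Longrightarrow> a' $ i < b' $ i"
  shows "a' <\<^sub>2 b'"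
proof -
  have "card {i. a $ i < b $ i} \<le> card {i. a' $ i < b' $ i}"
    using assms(2) by (intro card_mono) auto
  then show ?thesis
    using assms(1) by (simp add: two_less_def)
qed

lemma two_comparable_mono:
  assumes "two_comparable a b"
    and "\<And>i. a $ i < b $ i \<Longrightarrow> a' $ i < b' $ i" "\<And>i. b $ i < a $ i \<Longrightarrow> b' $ i < a' $ i"
  shows "two_comparable a' b'"
  using assms two_less_mono unfolding two_comparable_def by metis

lemma lex_less:
  fixes a b u v d :: int
  assumes "a < b" "u < d" "0 \<le> v" "0 \<le> d"
  shows "d * a + u < d * b + v"
proof -
  have "d * (a + 1) \<le> d * b"
    using assms by (intro mult_left_mono) auto
  then show ?thesis
    using assms by (simp add: algebra_simps)
qed

text \<open>The low parts are too small to outweigh a unit step of the high parts, so a strict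
  inequality between coordinates of \<open>a\<close> and \<open>a'\<close> survives in the same
  coordinate. When the high parts agree, the low parts decide.\<close>

lemma two_comparable_lex:
  assumes "a \<noteq> a' \<Longrightarrow> two_comparable a a'" "a = a' \<Longrightarrow> two_comparable b b'"
    and "\<And>i. b $ i \<in> {0..<d}" "\<And>i. b' $ i \<in> {0..<d}"
  shows "two_comparable (d *s a + b) (d *s a' + b')"
proof (cases "a = a'")
  case True
  then show ?thesis
    using assms(2) by (auto elim!: two_comparable_mono)
next
  case False
  have "0 \<le> d"
    using assms(3)[of 1] by simp
  then show ?thesis
    using assms(1)[OF False] assms(3,4)
    by (elim two_comparable_mono) (auto intro!: lex_less)
qed

text \<open>The head letter supplies the least significant base \<open>d\<close> digit of each
  coordinate, so later letters dominate the order.\<close>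

definition word_val :: "int \<Rightarrow> (int ^ 3) list \<Rightarrow> int ^ 3" where
  "word_val d ws = (\<chi> i. horner_sum (\<lambda>s. s $ i) d ws)"

lemma word_val_Cons: "word_val d (s # ws) = d *s word_val d ws + s"
  by (simp add: word_val_def vec_eq_iff)

lemma two_comparable_word_val:
  assumes "two_comparable_set S" "\<And>s i. s \<in> S \<Longrightarrow> s $ i \<in> {0..<d}"
    and "length ws = length ws'" "set ws \<subseteq> S" "set ws' \<subseteq> S" "ws \<noteq> ws'"
  shows "two_comparable (word_val d ws) (word_val d ws')"
  using assms(3-)
proof (induction ws ws' rule: list_induct2)
  case (Cons s ws s' ws')
  show ?case
    unfolding word_val_Cons
  proof (rule two_comparable_lex)
    assume "word_val d ws \<noteq> word_val d ws'"
    then show "two_comparable (word_val d ws) (word_val d ws')"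
      using Cons by auto
  next
    \<comment> \<open>Equal values force equal tails: otherwise the induction hypothesis would make
      a triple comparable to itself. Hence the heads differ.\<close>
    assume "word_val d ws = word_val d ws'"
    then have "ws = ws'"
      using Cons two_comparable_irrefl by (metis list.set_intros(2) subset_eq)
    then show "two_comparable s s'"
      using Cons assms(1) by (auto simp: two_comparable_set_def)
  qed (use Cons assms(2) in auto)
qed auto

section \<open>Compressing and symmetrising\<close>

text \<open>Only the order within each coordinate matters, so values may be replaced by their ranks
  among those that occur.\<close>

lemma two_comparable_set_compress:
  fixes A :: "(int ^ 3) set"
  assumes "two_comparable_set A" "finite A" "\<And>i. card ((\<lambda>x. x $ i) ` A) \<le> n"
  obtains B where "two_comparable_set B" "\<forall>b\<in>B. \<forall>i. b $ i \<in> {1..int n}" "card B = card A"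
proof -
  define rank where "rank i x = int (card {y \<in> (\<lambda>x. x $ i) ` A. y \<le> x})" for i and x :: int
  define f :: "int ^ 3 \<Rightarrow> int ^ 3" where "f x = (\<chi> i. rank i (x $ i))" for x
  \<comment> \<open>The value \<open>y $ i\<close> counts towards its own rank but not towards the
    rank of the smaller \<open>x $ i\<close>.\<close>
  have less: "rank i (x $ i) < rank i (y $ i)" if "x $ i < y $ i" "y \<in> A" for x y i
    unfolding rank_def of_nat_less_iff using that assms(2)
    by (intro psubset_card_mono) (auto simp: psubset_eq set_eq_iff intro!: exI[of _ "y $ i"])
  have comp: "two_comparable (f x) (f y)" if "x \<in> A" "y \<in> A" "x \<noteq> y" for x y
  proof (rule two_comparable_mono)
    show "two_comparable x y"
      using that assms(1) by (auto simp: two_comparable_set_def)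
  qed (auto simp: f_def less that)
  have "inj_on f A"
    using comp by (rule inj_on_if_two_comparable)
  then have "card (f ` A) = card A"
    by (rule card_image)
  moreover have "two_comparable_set (f ` A)"
    using comp by (rule two_comparable_set_image)
  moreover have "f x $ i \<in> {1..int n}" if "x \<in> A" for x i
  proof -
    have "rank i (x $ i) \<le> int (card ((\<lambda>x. x $ i) ` A))"
      unfolding rank_def using assms(2) by (intro of_nat_mono card_mono) auto
    moreover have "rank i (x $ i) > 0"
      unfolding rank_def using assms(2) that by (auto simp: card_gt_0_iff)
    ultimately show ?thesis
      using assms(3)[of i] by (simp add: f_def)
  qed
  ultimately show ?thesis
    using that by blast
qed

text \<open>Addition in the index type \<open>3\<close> is modulo 3, so this is a cyclic
  shift.\<close>

definition rotate_vec :: "int ^ 3 \<Rightarrow> int ^ 3" where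
  "rotate_vec x = (\<chi> i. x $ (i + 1))"

lemma two_comparable_rotate_vec:
  "two_comparable a b \<Longrightarrow> two_comparable (rotate_vec a) (rotate_vec b)"
proof -
  have "card {i. x $ (i + 1) < y $ (i + 1)} = card {i. x $ i < y $ i}" for x y :: "int ^ 3"
    by (rule bij_betw_same_card[of "\<lambda>i. i + 1"])
      (auto simp: bij_betw_def inj_on_def image_iff intro!: exI[of _ "_ - 1"])
  then show "two_comparable a b \<Longrightarrow> two_comparable (rotate_vec a) (rotate_vec b)"
    by (simp add: two_comparable_def two_less_def rotate_vec_def)
qed

lemma two_comparable_set_symmetrise:
  fixes A :: "(int ^ 3) set"
  assumes "two_comparable_set A" "finite A"
    and n: "n = (\<Prod>i\<in>UNIV. card ((\<lambda>x. x $ i) ` A))"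
  obtains B where "two_comparable_set B" "\<forall>b\<in>B. \<forall>i. b $ i \<in> {1..int n}" "card B = card A ^ 3"
proof -
  text \<open>Translate A into the nonnegative octant, where lexicographic products apply.\<close>
  define V where "V = (\<Union>i. (\<lambda>x. x $ i) ` A) \<union> {0}"
  have V: "finite V" "V \<noteq> {}"
    using assms(2) by (auto simp: V_def)
  define m where "m = Min V"
  define d where "d = Max V - Min V + 1"
  define sh :: "int ^ 3 \<Rightarrow> int ^ 3" where "sh x = (\<chi> i. x $ i - m)" for x
  have range: "sh x $ i \<in> {0..<d}" if "x \<in> A" for x i
  proof -
    have "x $ i \<in> V"
      using that by (auto simp: V_def)
    then have "Min V \<le> x $ i" "x $ i \<le> Max V"
      using V by auto
    then show ?thesis
      by (simp add: sh_def m_def d_def)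
  qed
  have sh: "two_comparable (sh x) (sh y)" if "x \<in> A" "y \<in> A" "x \<noteq> y" for x y
    using assms(1) that unfolding two_comparable_set_def
    by (auto simp: sh_def elim!: two_comparable_mono ballE)
  let ?r = rotate_vec
  define f where "f = (\<lambda>(x, y, z). d *s (d *s sh x + ?r (sh y)) + ?r (?r (sh z)))"
  have comp: "two_comparable (f p) (f q)"
    if p: "p \<in> A \<times> A \<times> A" and q: "q \<in> A \<times> A \<times> A" and "p \<noteq> q" for p q
  proof -
    obtain x y z x' y' z' where [simp]: "p = (x, y, z)" "q = (x', y', z')"
      by (cases p, cases q) auto
    have mem: "x \<in> A" "y \<in> A" "z \<in> A" "x' \<in> A" "y' \<in> A" "z' \<in> A"
      using p q by auto
    have first: "two_comparable (d *s sh x + ?r (sh y)) (d *s sh x' + ?r (sh y'))" if "(x, y) \<noteq> (x', y')"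
    proof (rule two_comparable_lex)
      assume "sh x \<noteq> sh x'"
      then show "two_comparable (sh x) (sh x')"
        using mem sh by blast
    next
      assume "sh x = sh x'"
      then have "x = x'"
        using mem sh two_comparable_irrefl by metis
      then show "two_comparable (?r (sh y)) (?r (sh y'))"
        using that mem by (auto intro!: two_comparable_rotate_vec sh)
    qed (use mem range in \<open>auto simp: rotate_vec_def\<close>)
    show ?thesis
      unfolding f_def \<open>p = _\<close> \<open>q = _\<close> prod.case
    proof (rule two_comparable_lex)
      assume "d *s sh x + ?r (sh y) \<noteq> d *s sh x' + ?r (sh y')"
      then show "two_comparable (d *s sh x + ?r (sh y)) (d *s sh x' + ?r (sh y'))"
        by (intro first) auto
    next
      assume "d *s sh x + ?r (sh y) = d *s sh x' + ?r (sh y')"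
      then have "(x, y) = (x', y')"
        using first two_comparable_irrefl by metis
      then show "two_comparable (?r (?r (sh z))) (?r (?r (sh z')))"
        using \<open>p \<noteq> q\<close> mem by (auto intro!: two_comparable_rotate_vec sh)
    qed (use mem range in \<open>auto simp: rotate_vec_def\<close>)
  qed
  have "inj_on f (A \<times> A \<times> A)"
    using comp by (rule inj_on_if_two_comparable)
  then have card: "card (f ` (A \<times> A \<times> A)) = card A ^ 3"
    by (simp add: card_image card_cartesian_product power3_eq_cube)
  have "two_comparable_set (f ` (A \<times> A \<times> A))"
    using comp by (rule two_comparable_set_image)
  moreover have "finite (f ` (A \<times> A \<times> A))"
    using assms(2) by auto
  \<comment> \<open>Coordinate \<open>i\<close> of the product is a function of coordinates
    \<open>i\<close>, \<open>i + 1\<close>, \<open>i + 2\<close> of the three factors, so the same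
    bound \<open>n\<close> holds for every \<open>i\<close>.\<close>
  moreover have "card ((\<lambda>x. x $ i) ` f ` (A \<times> A \<times> A)) \<le> n" for i
  proof -
    let ?P = "\<lambda>i. (\<lambda>x. x $ i) ` A"
    let ?Q = "?P i \<times> ?P (i + 1) \<times> ?P (i + 1 + 1)"
    let ?g = "\<lambda>(u, v, w). d * (d * (u - m) + (v - m)) + (w - m)"
    have "(\<lambda>x. x $ i) ` f ` (A \<times> A \<times> A) =
      ?g ` (\<lambda>(x, y, z). (x $ i, y $ (i + 1), z $ (i + 1 + 1))) ` (A \<times> A \<times> A)"
      by (simp add: image_image case_prod_unfold f_def rotate_vec_def sh_def algebra_simps)
    also have "\<dots> \<subseteq> ?g ` ?Q"
      by (intro image_mono) auto
    finally have "(\<lambda>x. x $ i) ` f ` (A \<times> A \<times> A) \<subseteq> ?g ` ?Q" .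
    then have "card ((\<lambda>x. x $ i) ` f ` (A \<times> A \<times> A)) \<le> card ?Q"
      using assms(2) by (intro surj_card_le) auto
    also have "\<dots> = card (?P i) * card (?P (i + 1)) * card (?P (i + 1 + 1))"
      by (simp add: card_cartesian_product)
    also have "\<dots> = n"
    proof -
      \<comment> \<open>The indices \<open>i + 1\<close> and \<open>i + 1 + 1\<close> can reach 4
        and 5, which must wrap around to match the factors of \<open>n\<close>.\<close>
      have mod_3: "(4 :: 3) = 1" "(5 :: 3) = 2"
        by simp_all
      show ?thesis
        unfolding n UNIV_3 using exhaust_3[of i] by (auto simp: mod_3 ac_simps)
    qed
    finally show ?thesis .
  qed
  ultimately obtain B where "two_comparable_set B" "\<forall>b\<in>B. \<forall>i. b $ i \<in> {1..int n}"
    "card B = card (f ` (A \<times> A \<times> A))"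
    by (rule two_comparable_set_compress)
  then show ?thesis
    using that card by metis
qed

lemma card_le_prod_card_coordinates:
  fixes A :: "('a ^ 'n) set"
  assumes "finite A"
  shows "card A \<le> (\<Prod>i\<in>UNIV. card ((\<lambda>x. x $ i) ` A))"
proof -
  have "card A = card (vec_nth ` A)"
    by (rule card_image[symmetric]) (auto simp: inj_on_def vec_eq_iff)
  also have "\<dots> \<le> card (PiE UNIV (\<lambda>i. (\<lambda>x. x $ i) ` A))"
    using assms by (intro card_mono finite_PiE) auto
  finally show ?thesis
    by (simp add: card_PiE)
qed

section \<open>Weights of words\<close>

definition words :: "'a set \<Rightarrow> nat \<Rightarrow> 'a list set" where
  "words S L = {ws. set ws \<subseteq> S \<and> length ws = L}"

lemma finite_words [simp]: "finite S \<Longrightarrow> finite (words S L)"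
  by (simp add: words_def finite_lists_length_eq)

text \<open>Expanding the power gives one term per word. This serves both for the total weight of
  words over \<open>S\<close> and for the total probability of digit strings in one
  coordinate.\<close>

lemma sum_prod_list_words:
  fixes w :: "'a \<Rightarrow> 'b :: comm_semiring_1"
  assumes "finite S"
  shows "(\<Sum>ws\<in>words S L. prod_list (map w ws)) = (\<Sum>s\<in>S. w s) ^ L"
proof (induction L)
  case 0
  have "words S 0 = {[]}"
    by (auto simp: words_def)
  then show ?case
    by simp
next
  case (Suc L)
  have eq: "words S (Suc L) = (\<lambda>(s, ws). s # ws) ` (S \<times> words S L)"
    by (auto simp: words_def length_Suc_conv image_iff)
  have "(\<Sum>ws\<in>words S (Suc L). prod_list (map w ws)) =
      (\<Sum>(s, ws)\<in>S \<times> words S L. w s * prod_list (map w ws))"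
    unfolding eq by (subst sum.reindex) (auto simp: inj_on_def case_prod_unfold)
  also have "\<dots> = (\<Sum>s\<in>S. w s) * (\<Sum>ws\<in>words S L. prod_list (map w ws))"
    by (simp add: sum_product sum.cartesian_product)
  finally show ?case
    using Suc by simp
qed

text \<open>The multiset of letters is determined by \<open>card S\<close> multiplicities, each
  between 0 and \<open>L\<close>.\<close>

lemma card_mset_words_le:
  assumes "finite S"
  shows "card (mset ` words S L) \<le> (L + 1) ^ card S"
proof -
  let ?f = "\<lambda>M. restrict (count M) S"
  have "inj_on ?f (mset ` words S L)"
  proof (rule inj_onI)
    fix M N
    assume "M \<in> mset ` words S L" "N \<in> mset ` words S L" and eq: "?f M = ?f N"
    then have "set_mset M \<subseteq> S" "set_mset N \<subseteq> S"
      by (auto simp: words_def)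
    moreover have "count M x = count N x" if "x \<in> S" for x
      using fun_cong[OF eq, of x] that by simp
    ultimately show "M = N"
      by (intro multiset_eqI) (metis not_in_iff subset_iff)
  qed
  moreover have "?f ` mset ` words S L \<subseteq> PiE S (\<lambda>_. {..L})"
    by (auto simp: words_def) (metis count_le_size size_mset)
  ultimately have "card (mset ` words S L) \<le> card (PiE S (\<lambda>_. {..L}))"
    using assms by (intro card_inj_on_le) (auto intro: finite_PiE)
  also have "\<dots> = (L + 1) ^ card S"
    using assms by (simp add: card_PiE)
  finally show ?thesis .
qed

text \<open>Pigeonhole: among at most \<open>K\<close> fibres, one carries at least the average
  share of the total weight.\<close>

lemma ex_sum_fibre_ge:
  fixes w :: "'a \<Rightarrow> real"
  assumes "finite A" "A \<noteq> {}" "real (card (f ` A)) \<le> K" "\<And>x. x \<in> A \<Longrightarrow> 0 \<le> w x"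
  obtains y where "y \<in> f ` A" "(\<Sum>x\<in>A. w x) \<le> K * (\<Sum>x\<in>{x \<in> A. f x = y}. w x)"
proof -
  have "\<exists>y\<in>f ` A. (\<Sum>x\<in>A. w x) \<le> K * (\<Sum>x\<in>{x \<in> A. f x = y}. w x)"
  proof (rule ccontr)
    assume "\<not> ?thesis"
    then have less: "K * (\<Sum>x\<in>{x \<in> A. f x = y}. w x) < (\<Sum>x\<in>A. w x)" if "y \<in> f ` A" for y
      using that by force
    have "K * (\<Sum>x\<in>A. w x) = (\<Sum>y\<in>f ` A. K * (\<Sum>x\<in>{x \<in> A. f x = y}. w x))"
      using assms(1) sum.image_gen[of A w f] by (simp add: sum_distrib_left)
    also have "\<dots> < (\<Sum>y\<in>f ` A. \<Sum>x\<in>A. w x)"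
      using less assms by (intro sum_strict_mono) auto
    also have "\<dots> = real (card (f ` A)) * (\<Sum>x\<in>A. w x)"
      by simp
    also have "\<dots> \<le> K * (\<Sum>x\<in>A. w x)"
      using assms(3,4) by (intro mult_right_mono sum_nonneg) auto
    finally show False
      by simp
  qed
  then show ?thesis
    using that by blast
qed

lemma prod_list_powr_eq:
  fixes p :: "'i :: finite \<Rightarrow> 'a \<Rightarrow> real"
  assumes "\<And>i s. s \<in> set ws \<Longrightarrow> 0 \<le> p i s"
  shows "prod_list (map (\<lambda>s. (\<Prod>i\<in>UNIV. p i s) powr \<theta>) ws) =
    (\<Prod>i\<in>UNIV. prod_list (map (p i) ws)) powr \<theta>"
  using assms
proof (induction ws)
  case (Cons s ws)
  have "0 \<le> prod_list (map (p i) ws)" for i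
    using Cons.prems by (intro prod_list_nonneg) auto
  then show ?case
    using Cons by (simp add: prod.distrib powr_mult prod_nonneg)
qed simp

lemma ex_power_ge_mult_power:
  fixes \<Lambda> :: real
  assumes "\<Lambda> > 1"
  obtains L :: nat where "\<Lambda> ^ L \<ge> c * real (L + 1) ^ k"
proof -
  have "((\<lambda>L :: nat. c * real (L + 1) ^ k / \<Lambda> ^ L) \<longlongrightarrow> 0) at_top"
    using assms by real_asymp
  then have "\<forall>\<^sub>F L in at_top. c * real (L + 1) ^ k / \<Lambda> ^ L < 1"
    by (rule order_tendstoD) simp
  then obtain L :: nat where "c * real (L + 1) ^ k / \<Lambda> ^ L < 1"
    by (meson eventually_happens trivial_limit_sequentially)
  then show ?thesis
    using that[of L] assms by (simp add: field_simps)
qed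

lemma two_comparable_sets_of_weights:
  fixes S :: "(int ^ 3) set" and p :: "3 \<Rightarrow> int \<Rightarrow> real"
  assumes S: "two_comparable_set S" "finite S" "\<And>s i. s \<in> S \<Longrightarrow> s $ i \<in> {0..<d}"
    and pos: "\<And>i x. x \<in> {0..<d} \<Longrightarrow> 0 < p i x"
    and sum_le: "\<And>i. (\<Sum>x\<in>{0..<d}. p i x) \<le> 1"
    and "0 \<le> \<theta>"
    and gt: "(\<Sum>s\<in>S. (\<Prod>i\<in>UNIV. p i (s $ i)) powr \<theta>) > 1"
  shows "\<exists>n\<ge>N. \<exists>A :: (int ^ 3) set. two_comparable_set A \<and>
    (\<forall>a\<in>A. \<forall>i. a $ i \<in> {1..int n}) \<and> real (card A) \<ge> real n powr (3 * \<theta>)"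
proof -
  define w where "w s = (\<Prod>i\<in>UNIV. p i (s $ i)) powr \<theta>" for s :: "int ^ 3"
  define \<Lambda> where "\<Lambda> = (\<Sum>s\<in>S. w s)"
  have "\<Lambda> > 1"
    using gt by (simp add: \<Lambda>_def w_def)
  \<comment> \<open>The factor \<open>(L + 1) ^ card S\<close> pays for the pigeonhole step; the
    factor \<open>N + 1\<close> is kept in reserve to force \<open>n \<ge> N\<close>.\<close>
  then obtain L where L: "\<Lambda> ^ L \<ge> real (N + 1) * real (L + 1) ^ card S"
    by (rule ex_power_ge_mult_power)
  define K where "K = real (L + 1) ^ card S"
  have "K > 0"
    by (simp add: K_def)
  have "S \<noteq> {}"
    using gt by auto
  then obtain s where "s \<in> S"
    by blast
  then have "replicate L s \<in> words S L"
    by (auto simp: words_def)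
  then have ne: "words S L \<noteq> {}"
    by blast
  have "real (card (mset ` words S L)) \<le> K"
    unfolding K_def using card_mset_words_le[OF S(2), of L] by (metis of_nat_le_iff of_nat_power)
  moreover have "0 \<le> prod_list (map w ws)" if "ws \<in> words S L" for ws
    by (intro prod_list_nonneg) (auto simp: w_def)
  ultimately obtain M where "M \<in> mset ` words S L"
    and M: "(\<Sum>ws\<in>words S L. prod_list (map w ws)) \<le>
      K * (\<Sum>ws\<in>{ws \<in> words S L. mset ws = M}. prod_list (map w ws))"
    by (rule ex_sum_fibre_ge[OF finite_words[OF S(2)] ne])
  define C where "C = {ws \<in> words S L. mset ws = M}"
  have "finite C"
    using S(2) by (simp add: C_def)
  then have C: "finite C" "C \<noteq> {}" "\<And>ws. ws \<in> C \<Longrightarrow> set ws \<subseteq> S \<and> length ws = L"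
    using \<open>M \<in> _\<close> by (auto simp: C_def words_def)
  have prod_C: "prod_list (map f ws) = prod_mset (image_mset f M)"
    if "ws \<in> C" for ws and f :: "int ^ 3 \<Rightarrow> real"
    using that by (auto simp: C_def simp flip: prod_mset_prod_list)
  \<comment> \<open>This depends only on the letter frequencies \<open>M\<close>, so it is the
    probability in coordinate \<open>i\<close> of every word of the class.\<close>
  define P where "P i = prod_mset (image_mset (\<lambda>s. p i (s $ i)) M)" for i
  obtain ws0 where ws0: "ws0 \<in> C"
    using C by blast
  have P_eq: "prod_list (map (\<lambda>s. p i (s $ i)) ws) = P i" if "ws \<in> C" for ws i
    using prod_C[OF that] by (simp add: P_def)
  have P_pos: "P i > 0" for i
  proof -
    have "prod_list (map (\<lambda>s. p i (s $ i)) ws) > 0" if "set ws \<subseteq> S" for ws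
      using that
    proof (induction ws)
      case (Cons s ws)
      then show ?case
        using pos[OF S(3)] by simp
    qed simp
    then show ?thesis
      using P_eq[OF ws0] C(3)[OF ws0] by metis
  qed
  have "prod_list (map w ws) = (\<Prod>i\<in>UNIV. P i) powr \<theta>" if "ws \<in> C" for ws
  proof -
    have "0 \<le> p i (s $ i)" if "s \<in> set ws" for s i
      using that C(3)[OF \<open>ws \<in> C\<close>] S(3) pos by (meson less_imp_le subsetD)
    then show ?thesis
      unfolding w_def using prod_list_powr_eq[of ws "\<lambda>i s. p i (s $ i)" \<theta>] P_eq[OF that] by simp
  qed
  then have "\<Lambda> ^ L \<le> K * (card C * (\<Prod>i\<in>UNIV. P i) powr \<theta>)"
    using M sum_prod_list_words[OF S(2), of w L] by (simp add: \<Lambda>_def flip: C_def)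
  then have "K * real (N + 1) \<le> K * (card C * (\<Prod>i\<in>UNIV. P i) powr \<theta>)"
    using L unfolding K_def by (subst mult.commute) (rule order.trans)
  then have weight: "real (N + 1) \<le> card C * (\<Prod>i\<in>UNIV. P i) powr \<theta>"
    using \<open>K > 0\<close> by simp

  define T where "T = word_val d ` C"
  have comp: "two_comparable (word_val d ws) (word_val d ws')"
    if "ws \<in> C" "ws' \<in> C" "ws \<noteq> ws'" for ws ws'
    using that C(3) by (intro two_comparable_word_val[OF S(1,3)]) auto
  have "inj_on (word_val d) C"
    using comp by (rule inj_on_if_two_comparable)
  then have card_T: "card T = card C"
    unfolding T_def by (rule card_image)
  have T: "two_comparable_set T" "finite T"
    unfolding T_def using comp C(1) by (auto intro: two_comparable_set_image)
  define n where "n = (\<Prod>i\<in>UNIV. card ((\<lambda>x. x $ i) ` T))"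
  \<comment> \<open>The distinct digit strings of coordinate \<open>i\<close> have probability
    \<open>P i\<close> each, while all strings of length \<open>L\<close> together have probability
    at most 1.\<close>
  have coord: "real (card ((\<lambda>x. x $ i) ` T)) * P i \<le> 1" for i
  proof -
    define Q where "Q = map (\<lambda>s. s $ i) ` C"
    have Q: "finite Q" "Q \<subseteq> words {0..<d} L"
      using C(1,3) S(3) unfolding Q_def words_def by (auto, (meson subsetD)+)
    have "word_val d ws $ i = horner_sum id d (map (\<lambda>s. s $ i) ws)" for ws
      by (induction ws) (simp_all add: word_val_def)
    then have "(\<lambda>x. x $ i) ` T = horner_sum id d ` Q"
      by (simp add: T_def Q_def image_image)
    then have "card ((\<lambda>x. x $ i) ` T) \<le> card Q"
      using Q(1) by (simp add: card_image_le)
    then have "card ((\<lambda>x. x $ i) ` T) * P i \<le> card Q * P i"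
      using P_pos[of i] by simp
    also have "\<dots> = (\<Sum>v\<in>Q. prod_list (map (p i) v))"
    proof -
      have "prod_list (map (p i) v) = P i" if "v \<in> Q" for v
        using that P_eq[of _ i] by (auto simp: Q_def o_def)
      then show ?thesis
        by simp
    qed
    also have "\<dots> \<le> (\<Sum>v\<in>words {0..<d} L. prod_list (map (p i) v))"
    proof (rule sum_mono2)
      show "0 \<le> prod_list (map (p i) v)" if "v \<in> words {0..<d} L - Q" for v
        using that pos by (intro prod_list_nonneg) (auto simp: words_def intro!: less_imp_le)
    qed (use Q in auto)
    also have "\<dots> = (\<Sum>x\<in>{0..<d}. p i x) ^ L"
      by (rule sum_prod_list_words) simp
    also have "\<dots> \<le> 1"
      using sum_le pos by (intro power_le_one sum_nonneg) (auto intro: less_imp_le)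
    finally show ?thesis .
  qed
  have "(\<Prod>i\<in>UNIV. real (card ((\<lambda>x. x $ i) ` T)) * P i) \<le> 1"
    using coord P_pos by (intro prod_le_1) (simp add: less_imp_le)
  then have "real n * (\<Prod>i\<in>UNIV. P i) \<le> 1"
    by (simp add: n_def prod.distrib)
  moreover have "(\<Prod>i\<in>UNIV. P i) > 0"
    using P_pos by (intro prod_pos) auto
  ultimately have "(real n * (\<Prod>i\<in>UNIV. P i)) powr \<theta> \<le> 1"
    using \<open>0 \<le> \<theta>\<close> by (intro powr_le1) auto
  then have nP: "real n powr \<theta> * (\<Prod>i\<in>UNIV. P i) powr \<theta> \<le> 1"
    using \<open>(\<Prod>i\<in>UNIV. P i) > 0\<close> by (simp add: powr_mult)
  have "card T > 0"
    using C card_T by (simp add: card_gt_0_iff)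
  moreover have "card T \<le> n"
    unfolding n_def using T(2) by (rule card_le_prod_card_coordinates)
  ultimately have "n \<ge> 1"
    by simp
  \<comment> \<open>Multiplying the two bounds lets the unknown product of the \<open>P i\<close>
    cancel.\<close>
  have "real n powr \<theta> * (\<Prod>i\<in>UNIV. P i) powr \<theta> * real (N + 1) \<le>
      1 * (real (card T) * (\<Prod>i\<in>UNIV. P i) powr \<theta>)"
    using nP weight card_T by (intro mult_mono) auto
  then have "(\<Prod>i\<in>UNIV. P i) powr \<theta> * (real n powr \<theta> * real (N + 1)) \<le>
      (\<Prod>i\<in>UNIV. P i) powr \<theta> * real (card T)"
    by (simp add: ac_simps)
  moreover have "(\<Prod>i\<in>UNIV. P i) powr \<theta> > 0"
    using P_pos by (simp add: less_imp_neq[symmetric])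
  ultimately have big: "real n powr \<theta> * real (N + 1) \<le> real (card T)"
    by (rule mult_left_le_imp_le)
  \<comment> \<open>The reserved factor now gives \<open>N + 1 \<le> card T \<le> n\<close>.\<close>
  have "1 \<le> real n powr \<theta>"
    using \<open>n \<ge> 1\<close> \<open>0 \<le> \<theta>\<close> by (intro ge_one_powr_ge_zero) auto
  then have "real (N + 1) \<le> real n powr \<theta> * real (N + 1)"
    by simp
  then have "N \<le> n"
    using big \<open>card T \<le> n\<close> by linarith
  have "real n powr \<theta> * 1 \<le> real n powr \<theta> * real (N + 1)"
    by (intro mult_left_mono) auto
  then have "(real n powr \<theta>) ^ 3 \<le> real (card T) ^ 3"
    using big by (intro power_mono) auto
  moreover have "(real n powr \<theta>) ^ 3 = real n powr (3 * \<theta>)"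
    using \<open>n \<ge> 1\<close> by (simp add: powr_power mult.commute)
  moreover obtain B where "two_comparable_set B" "\<forall>b\<in>B. \<forall>i. b $ i \<in> {1..int n}"
    "card B = card T ^ 3"
    using two_comparable_set_symmetrise[OF T n_def] by blast
  ultimately show ?thesis
    using \<open>N \<le> n\<close> by (metis of_nat_power)
qed

section \<open>The five-point set\<close>

text \<open>The last three points are the cyclic rotations of 210. The set is invariant under
  rotation, so one letter distribution serves all coordinates.\<close>

definition five_points :: "(int ^ 3) set" where
  "five_points =
    {vector [0, 0, 0], vector [2, 2, 2], vector [2, 1, 0], vector [1, 0, 2], vector [0, 2, 1]}"

lemma two_comparable_iff:
  "two_comparable a b \<longleftrightarrow>
    (a $ 1 < b $ 1 \<and> a $ 2 < b $ 2 \<or> a $ 1 < b $ 1 \<and> a $ 3 < b $ 3 \<or> a $ 2 < b $ 2 \<and> a $ 3 < b $ 3) \<or>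
    (b $ 1 < a $ 1 \<and> b $ 2 < a $ 2 \<or> b $ 1 < a $ 1 \<and> b $ 3 < a $ 3 \<or> b $ 2 < a $ 2 \<and> b $ 3 < a $ 3)"
proof -
  have "card {i. P i} = of_bool (P 1) + of_bool (P 2) + of_bool (P 3)" for P :: "3 \<Rightarrow> bool"
  proof -
    have "card {i. P i} = (\<Sum>i\<in>UNIV. of_bool (P i))"
      by simp
    then show ?thesis
      by (simp only: sum_3)
  qed
  then show ?thesis
    unfolding two_comparable_def two_less_def by (auto simp: of_bool_def split: if_splits)
qed

lemma two_comparable_set_five_points: "two_comparable_set five_points"
  by (simp add: two_comparable_set_def five_points_def two_comparable_iff)

text \<open>The Lagrange remainder contains an even power of \<open>x\<close>, so it is nonnegative
  for negative \<open>x\<close> too.\<close>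

lemma exp_ge_Taylor_even:
  fixes x :: real
  assumes "even n"
  shows "(\<Sum>m<n. x ^ m / fact m) \<le> exp x"
proof -
  obtain t where "exp x = (\<Sum>m<n. x ^ m / fact m) + exp t / fact n * x ^ n"
    using Maclaurin_exp_le[of x n] by blast
  moreover have "0 \<le> exp t / fact n * x ^ n"
    using assms by (simp add: zero_le_power_eq)
  ultimately show ?thesis
    by linarith
qed

text \<open>Costs are negated logarithms of the letter probabilities, whose optimal values are about
  0.4207, 0.1585, 0.4207.\<close>

definition digit_cost :: "int \<Rightarrow> real" where
  "digit_cost x = (if x = 1 then 1.82 else 0.87)"

lemma sum_exp_digit_cost_le: "(\<Sum>x\<in>{0..<3}. exp (- digit_cost x)) \<le> 1"
proof -
  have "{0..<3 :: int} = {0, 1, 2}"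
    by auto
  moreover have "exp (- 87 / 100 :: real) \<le> 0.41896"
  proof -
    \<comment> \<open>An upper bound at a negative argument comes from a lower bound for the
      reciprocal. The margin is thin: 2 * 0.41896 + 0.16204 = 0.99996.\<close>
    have "1 / 0.41896 \<le> exp (87 / 100 :: real)"
      by (rule order.trans[OF _ exp_ge_Taylor_even[of 12]])
        (simp_all add: lessThan_nat_numeral fact_numeral power_divide)
    then show ?thesis
      by (simp add: exp_minus field_simps)
  qed
  moreover have "exp (- 182 / 100 :: real) \<le> 0.16204"
  proof -
    have "1 / 0.16204 \<le> exp (182 / 100 :: real)"
      by (rule order.trans[OF _ exp_ge_Taylor_even[of 12]])
        (simp_all add: lessThan_nat_numeral fact_numeral power_divide)
    then show ?thesis
      by (simp add: exp_minus field_simps)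
  qed
  ultimately show ?thesis
    by (simp add: digit_cost_def)
qed

lemma sum_five_points_gt:
  "(\<Sum>s\<in>five_points. (\<Prod>i\<in>UNIV. exp (- digit_cost (s $ i))) powr (1.546 / 3)) > 1"
proof -
  \<comment> \<open>The points 000 and 222 cost 3 * 0.87, the other three 2 * 0.87 + 1.82 = 3.56;
    the sum is at least 2 * 0.26053 + 3 * 0.15967 = 1.00007.\<close>
  have "exp (- 1.546 * 0.87 :: real) \<ge> 0.26053"
    by (rule order.trans[OF _ exp_ge_Taylor_even[of 12]])
        (simp_all add: lessThan_nat_numeral fact_numeral power_divide)
  moreover have "exp (- 1.546 * 3.56 / 3 :: real) \<ge> 0.15967"
    by (rule order.trans[OF _ exp_ge_Taylor_even[of 12]])
        (simp_all add: lessThan_nat_numeral fact_numeral power_divide)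
  moreover have "(\<Prod>i\<in>UNIV. exp (- digit_cost (s $ i))) powr (1.546 / 3) =
    exp (- 1.546 * (digit_cost (s $ 1) + digit_cost (s $ 2) + digit_cost (s $ 3)) / 3)" for s :: "int ^ 3"
    by (simp add: exp_powr_real sum_3 flip: exp_sum) (simp add: algebra_simps)
  ultimately show ?thesis
    by (simp add: five_points_def vec_eq_iff forall_3 digit_cost_def)
qed

theorem theorem1p14:
  fixes N :: nat
  assumes "N > 0"
  shows "\<exists>n\<ge>N. \<exists>A :: (int ^ 3) set.
           two_comparable_set A \<and>
           (\<forall>a\<in>A. \<forall>i. a $ i \<in> {1..int n}) \<and>
           real (card A) \<ge> real n powr 1.546"
proof -
  have "\<exists>n\<ge>N. \<exists>A :: (int ^ 3) set. two_comparable_set A \<and>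
    (\<forall>a\<in>A. \<forall>i. a $ i \<in> {1..int n}) \<and> real (card A) \<ge> real n powr (3 * (1.546 / 3))"
  proof (rule two_comparable_sets_of_weights)
    show "two_comparable_set five_points"
      by (rule two_comparable_set_five_points)
    show "s $ i \<in> {0..<3}" if "s \<in> five_points" for s i
      using that exhaust_3[of i] by (auto simp: five_points_def)
    show "(\<Sum>x\<in>{0..<3}. exp (- digit_cost x)) \<le> 1"
      by (rule sum_exp_digit_cost_le)
    show "(\<Sum>s\<in>five_points. (\<Prod>i\<in>UNIV. exp (- digit_cost (s $ i))) powr (1.546 / 3)) > 1"
      by (rule sum_five_points_gt)
  qed (simp_all add: five_points_def)
  then show ?thesis
    by simp
qed

end
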